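(* Let $\{\lambda_k\}_{k\in\mathbb Z}$ be a complex sequence with $\lambda_0=0$, $\lambda_k=\overline{\lambda_{-k}}$ and $\sum_{k\in\mathbb Z}|\lambda_k|<\infty$. Let $a_0,q_0$ be positive integers with $\gcd(a_0,q_0)=1$ such that $\sum_{m=1}^\infty\lambda_{m^2d_0}G(a_0m^2d_0;q_0)\neq0$ for some square-free positive integer $d_0$. Let $b,B$ be positive integers with $8q_0\mid B$ and $\gcd(b,B)=1$, and let $\eta>0$ be such that $\left|\sum_{k\in\mathbb Z}\lambda_kG(ka_0;q_0)\left(\frac kp\right)\right|\ge\eta$ for all odd primes $p\equiv b\pmod B$. Fix $0<C_1<C_2$. For a sufficiently large integer $N$ define $$\mathcal P_N:=\{p\ \text{prime}:\ C_1\sqrt N\le p\le C_2\sqrt N\},$$ and for $p\in\mathcal P_N$ and $a\in R(p)$ define $$D_{p,a}:=\left[x_A,\ x_A+\frac1{p^2}\right],\qquad x_A=\frac{A}{q_0p}\in(0,1),$$ where $A$ is the integer with $0<A<q_0p$ satisfying $A\equiv a_0b\pmod{q_0}$ and $A\equiv a\pmod p$. Then for any continuous function $F:[0,1]\to\mathbb R$, $$\underline{\dim}_{\mathrm B}(\mathrm{graph}\,F)\ \ge\ \liminf_{N\to\infty}\frac{\log\left(N\sum_{p\in\mathcal P_N}\sum_{a\in R(p)}\mathrm{osc}(F;D_{p,a})\right)}{\log N}.$$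
   Context: $R(p)$ denotes the set of (nonzero) quadratic residues modulo the prime $p$, and $\left(\frac{\cdot}{p}\right)$ is the Legendre symbol. For integers $t$ and $q\ge1$, $G(t;q):=\frac1q\sum_{n=1}^{q}e^{2\pi i tn^2/q}$. For an interval $I$, $\mathrm{osc}(F;I)=\sup_{x\in I}F(x)-\inf_{x\in I}F(x)$. The graph of $F$ is $\{(x,F(x)):x\in[0,1]\}$. The lower box dimension is $\underline{\dim}_{\mathrm B}(E)=\liminf_{N\to\infty}\frac{\log A_N(E)}{\log N}$, where $A_N(E)$ is the minimum number of boxes of side $1/N$ needed to cover $E$. For $N$ large every $p\in\mathcal P_N$ is coprime to $q_0$, so $A$ is uniquely determined. Convention: $\log 0=-\infty$. *)

theory Defs
  imports
    "HOL-Analysis.Analysis"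
    "HOL-Number_Theory.Number_Theory"
    "HOL-Computational_Algebra.Squarefree"
begin

definition gauss_mean :: "int \<Rightarrow> nat \<Rightarrow> complex" where
  "gauss_mean t q =
     (1 / of_nat q) *
     (\<Sum>n=1..q. exp (2 * of_real pi * \<i> * of_int t * of_nat n ^ 2 / of_nat q))"

(* The residue classes are represented in {1,...,p-1}. *)
definition quad_residues :: "nat \<Rightarrow> nat set" where
  "quad_residues p = {a. 0 < a \<and> a < p \<and> QuadRes (int p) (int a)}"

definition osc :: "(real \<Rightarrow> real) \<Rightarrow> real set \<Rightarrow> real" where
  "osc F I = (SUP x\<in>I. F x) - (INF x\<in>I. F x)"

definition graph01 :: "(real \<Rightarrow> real) \<Rightarrow> (real \<times> real) set" where
  "graph01 F = (\<lambda>x. (x, F x)) ` {0..1}"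

(* The logarithm of a nonnegative real with the convention log 0 = -\<infinity>
   (the library has ln 0 = 0). *)
definition elog :: "real \<Rightarrow> ereal" where
  "elog x = (if x > 0 then ereal (ln x) else -\<infinity>)"

definition square_box :: "nat \<Rightarrow> real \<times> real \<Rightarrow> (real \<times> real) set" where
  "square_box N c = {fst c .. fst c + 1 / real N} \<times> {snd c .. snd c + 1 / real N}"

(* Minimal number of boxes of side 1/N, placed anywhere in the plane, covering E.
   The minimum is over a nonempty set only for bounded E and N > 0. *)
definition box_count :: "(real \<times> real) set \<Rightarrow> nat \<Rightarrow> nat" where
  "box_count E N =
     (LEAST n. \<exists>C. finite C \<and> card C = n \<and> E \<subseteq> (\<Union>c\<in>C. square_box N c))"

definition lower_box_dim :: "(real \<times> real) set \<Rightarrow> ereal" where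
  "lower_box_dim E =
     liminf (\<lambda>N. elog (real (box_count E N)) / ereal (ln (real N)))"

definition prime_window :: "real \<Rightarrow> real \<Rightarrow> nat \<Rightarrow> nat set" where
  "prime_window C1 C2 N =
     {p. prime p \<and> C1 * sqrt (real N) \<le> real p \<and> real p \<le> C2 * sqrt (real N)}"

(* Uniquely determined when p is a prime not dividing q0 and p does not divide a. *)
definition crt_num :: "nat \<Rightarrow> nat \<Rightarrow> nat \<Rightarrow> nat \<Rightarrow> nat \<Rightarrow> int" where
  "crt_num a0 q0 b p a =
     (THE A. 0 < A \<and> A < int q0 * int p \<and>
             [A = int a0 * int b] (mod int q0) \<and> [A = int a] (mod int p))"

definition D_interval :: "nat \<Rightarrow> nat \<Rightarrow> nat \<Rightarrow> nat \<Rightarrow> nat \<Rightarrow> real set" where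
  "D_interval a0 q0 b p a =
     (let x = of_int (crt_num a0 q0 b p a) / (real q0 * real p)
      in {x .. x + 1 / (real p)\<^sup>2})"

end

theory Submission
  imports Defs "HOL-Real_Asymp.Real_Asymp"
begin

text \<open>
  Cover the graph by \<open>n\<close> boxes of side \<open>1/N\<close>. By the intermediate value theorem, the boxes
  meeting the part of the graph above \<open>D\<close> project onto an interval of length \<open>osc F D\<close>, so there
  are at least \<open>N osc F D\<close> of them. The left endpoints of the intervals \<open>D\<^bsub>p,a\<^esub>\<close> are distinct fractions
  with denominators \<open>q0 p\<close>, hence are \<open>1/(q0 C2\<^sup>2 N)\<close>-separated, while the intervals have length at most
  \<open>1/(C1\<^sup>2 N)\<close>; so each box lies over at most \<open>K\<close> of them, with \<open>K\<close> independent of \<open>N\<close>. Counting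
  incidences gives \<open>N \<Sum> osc F D\<^bsub>p,a\<^esub> \<le> K n\<close>, and \<open>ln K / ln N\<close> tends to \<open>0\<close>.
\<close>

section \<open>Counting boxes over intervals of the base line\<close>

lemma osc_le_boxes_met:
  assumes cont: "continuous_on {u..v} F" and uv: "u \<le> v" and N: "N > 0" and C: "finite C"
    and cover: "\<And>x. x \<in> {u..v} \<Longrightarrow> (x, F x) \<in> (\<Union>c\<in>C. square_box N c)"
  shows "real N * osc F {u..v} \<le>
    real (card {c \<in> C. {fst c .. fst c + 1 / real N} \<inter> {u..v} \<noteq> {}})"
proof -
  define H where "H = {c \<in> C. {fst c .. fst c + 1 / real N} \<inter> {u..v} \<noteq> {}}"
  define T :: "real \<times> real \<Rightarrow> real set" where "T c = {snd c .. snd c + 1 / real N}" for c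
  have finH: "finite H"
    using C by (simp add: H_def)
  obtain m M where mM: "F ` {u..v} = {m..M}" "m \<le> M"
    using continuous_image_closed_interval[OF uv cont] by blast
  have "{m..M} \<subseteq> (\<Union>c\<in>H. T c)"
  proof -
    have "F x \<in> (\<Union>c\<in>H. T c)" if x: "x \<in> {u..v}" for x
    proof -
      obtain c where "c \<in> C" "(x, F x) \<in> square_box N c"
        using cover[OF x] by blast
      then have "c \<in> H" "F x \<in> T c"
        using x by (auto simp: H_def T_def square_box_def)
      then show ?thesis by blast
    qed
    then have "F ` {u..v} \<subseteq> (\<Union>c\<in>H. T c)"
      by (rule image_subsetI)
    then show ?thesis
      unfolding mM(1) .
  qed
  \<comment> \<open>The inclusion becomes a count through Lebesgue measure: each \<open>T c\<close>
    has length \<open>1 / real N\<close>, so by subadditivity the sides in \<open>H\<close> have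
    total length at least \<open>M - m\<close>, which is the oscillation.\<close>
  then have "measure lborel {m..M} \<le> measure lborel (\<Union>c\<in>H. T c)"
    using finH by (intro measure_mono_fmeasurable fmeasurable.finite_UN) (auto simp: T_def intro: fmeasurable_compact)
  also have "\<dots> \<le> (\<Sum>c\<in>H. measure lborel (T c))"
    using finH by (intro measure_UNION_le) (auto simp: T_def)
  also have "\<dots> = real (card H) / real N"
    by (simp add: T_def)
  finally have "M - m \<le> real (card H) / real N"
    using mM(2) by simp
  moreover have "osc F {u..v} = M - m"
    using mM by (simp add: osc_def)
  ultimately show ?thesis
    using N unfolding H_def[symmetric] by (simp add: pos_le_divide_eq mult.commute)
qed

text \<open>Pigeonhole: cut the line from \<open>u\<close> into half-open cells of length
  \<open>\<delta>\<close>. Points at distance at least \<open>\<delta>\<close> have distinct cell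
  indices \<open>g i\<close>, and these lie between 0 and the floor of
  \<open>(v - u) / \<delta>\<close>; index 0 accounts for the \<open>+ 1\<close>.\<close>

lemma card_separated_le:
  fixes x :: "'a \<Rightarrow> real"
  assumes \<delta>: "\<delta> > 0" and uv: "u \<le> v" and range: "\<And>i. i \<in> I \<Longrightarrow> x i \<in> {u..v}"
    and sep: "\<And>i j. \<lbrakk>i \<in> I; j \<in> I; i \<noteq> j\<rbrakk> \<Longrightarrow> \<delta> \<le> \<bar>x i - x j\<bar>"
  shows "real (card I) \<le> (v - u) / \<delta> + 1"
proof -
  define g where "g i = \<lfloor>(x i - u) / \<delta>\<rfloor>" for i
  have "inj_on g I"
  proof (rule inj_onI, rule ccontr)
    fix i j assume ij: "i \<in> I" "j \<in> I" "g i = g j" "i \<noteq> j"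
    have "\<bar>(x i - u) / \<delta> - (x j - u) / \<delta>\<bar> = \<bar>x i - x j\<bar> / \<delta>"
      using \<delta> by (simp add: diff_divide_distrib[symmetric])
    also have "\<dots> \<ge> 1"
      using sep[OF ij(1,2,4)] \<delta> by simp
    finally show False
      using ij(3) unfolding g_def by linarith
  qed
  moreover have "g ` I \<subseteq> {0..\<lfloor>(v - u) / \<delta>\<rfloor>}"
    using range \<delta> by (auto simp: g_def intro!: floor_mono divide_right_mono)
  ultimately have "card I \<le> card {0..\<lfloor>(v - u) / \<delta>\<rfloor>}"
    by (intro card_inj_on_le) auto
  moreover have "0 \<le> (v - u) / \<delta>"
    using \<delta> uv by simp
  ultimately show ?thesis
    by (simp add: le_nat_iff) linarith
qed

text \<open>The \<open>LEAST\<close> in \<open>box_count\<close> is attained once some finite cover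
  exists. Compactness provides one from open boxes, each contained in the closed box with the same
  corner.\<close>

lemma box_count_cover:
  assumes E: "compact E" and N: "N > 0"
  obtains C where "finite C" "card C = box_count E N" "E \<subseteq> (\<Union>c\<in>C. square_box N c)"
proof -
  define f :: "real \<times> real \<Rightarrow> (real \<times> real) set" where
    "f c = {fst c <..< fst c + 1 / real N} \<times> {snd c <..< snd c + 1 / real N}" for c
  have "E \<subseteq> (\<Union>c\<in>UNIV. f c)"
  proof
    fix z :: "real \<times> real"
    \<comment> \<open>The corner is shifted by half a side so that \<open>z\<close> is the centre of
      its open box.\<close>
    have "z \<in> f (fst z - 1 / (2 * real N), snd z - 1 / (2 * real N))"
      using N by (cases z) (auto simp: f_def field_simps)
    then show "z \<in> (\<Union>c\<in>UNIV. f c)" by blast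
  qed
  moreover have "open (f c)" for c
    unfolding f_def by (intro open_Times) auto
  ultimately obtain C where C: "finite C" "E \<subseteq> (\<Union>c\<in>C. f c)"
    using compactE_image[OF E, of UNIV f] by metis
  have "f c \<subseteq> square_box N c" for c
    by (auto simp: f_def square_box_def)
  then have "E \<subseteq> (\<Union>c\<in>C. square_box N c)"
    using C(2) by blast
  then have "\<exists>n C. finite C \<and> card C = n \<and> E \<subseteq> (\<Union>c\<in>C. square_box N c)"
    using C(1) by blast
  then have "\<exists>C. finite C \<and> card C = box_count E N \<and> E \<subseteq> (\<Union>c\<in>C. square_box N c)"
    unfolding box_count_def by (rule LeastI_ex)
  then show thesis
    using that by blast
qed

lemma compact_graph01:
  assumes "continuous_on {0..1} F"
  shows "compact (graph01 F)"
  unfolding graph01_def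
  using assms by (intro compact_continuous_image continuous_intros) auto

text \<open>Double counting of pairs (interval, box) where the projection of the box meets the
  interval: summing over intervals dominates the oscillations, summing over boxes is controlled by
  separation.\<close>

lemma sum_osc_le_box_count:
  fixes x l :: "'a \<Rightarrow> real"
  assumes cont: "continuous_on {0..1} F" and N: "N > 0" and I: "finite I"
    and D: "\<And>i. i \<in> I \<Longrightarrow> 0 \<le> x i \<and> 0 \<le> l i \<and> x i + l i \<le> 1"
    and l: "\<And>i. i \<in> I \<Longrightarrow> l i \<le> L / real N" and L: "0 \<le> L"
    and \<delta>: "\<delta> > 0"
    and sep: "\<And>i j. \<lbrakk>i \<in> I; j \<in> I; i \<noteq> j\<rbrakk> \<Longrightarrow> \<delta> / real N \<le> \<bar>x i - x j\<bar>"
  shows "real N * (\<Sum>i\<in>I. osc F {x i .. x i + l i})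
    \<le> ((1 + L) / \<delta> + 1) * real (box_count (graph01 F) N)"
proof -
  obtain C where C: "finite C" "card C = box_count (graph01 F) N"
      "graph01 F \<subseteq> (\<Union>c\<in>C. square_box N c)"
    using box_count_cover[OF compact_graph01[OF cont] N] .
  define R where "R i c \<longleftrightarrow> {fst c .. fst c + 1 / real N} \<inter> {x i .. x i + l i} \<noteq> {}"
    for i and c :: "real \<times> real"
  have "real N * (\<Sum>i\<in>I. osc F {x i .. x i + l i}) \<le> (\<Sum>i\<in>I. real (card {c \<in> C. R i c}))"
    unfolding sum_distrib_left R_def
  proof (rule sum_mono, rule osc_le_boxes_met[OF _ _ N C(1)])
    fix i assume i: "i \<in> I"
    then have sub: "{x i .. x i + l i} \<subseteq> {0..1}"
      using D[OF i] by auto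
    show "continuous_on {x i .. x i + l i} F"
      using cont sub by (rule continuous_on_subset)
    show "x i \<le> x i + l i"
      using D[OF i] by simp
    fix y assume "y \<in> {x i .. x i + l i}"
    then have "(y, F y) \<in> graph01 F"
      using sub by (auto simp: graph01_def)
    then show "(y, F y) \<in> (\<Union>c\<in>C. square_box N c)"
      using C(3) by blast
  qed
  also have "\<dots> = real (\<Sum>i\<in>I. card {c \<in> C. R i c})"
    by simp
  also have "(\<Sum>i\<in>I. card {c \<in> C. R i c}) = (\<Sum>c\<in>C. card {i \<in> I. R i c})"
    using sum_multicount_gen[OF I C(1), of R "\<lambda>c. card {i \<in> I. R i c}"] by simp
  also have "real \<dots> = (\<Sum>c\<in>C. real (card {i \<in> I. R i c}))"
    by simp
  also have "\<dots> \<le> (\<Sum>c\<in>C. (1 + L) / \<delta> + 1)"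
  proof (rule sum_mono)
    fix c assume "c \<in> C"
    \<comment> \<open>An interval of length at most \<open>L / real N\<close> meeting the projection
      of the box starts at most \<open>L / real N\<close> to its left. Window and separation both
      scale like \<open>1 / real N\<close>, so the bound does not depend on
      \<open>N\<close>.\<close>
    have "real (card {i \<in> I. R i c})
      \<le> ((fst c + 1 / real N) - (fst c - L / real N)) / (\<delta> / real N) + 1"
    proof (rule card_separated_le)
      show "0 < \<delta> / real N" "fst c - L / real N \<le> fst c + 1 / real N"
        using \<delta> N L by (auto intro: order_trans[of _ 0])
      show "x i \<in> {fst c - L / real N .. fst c + 1 / real N}" if "i \<in> {i \<in> I. R i c}" for i
        using that l[of i] by (auto simp: R_def)
    qed (use sep in auto)
    also have "\<dots> = (1 + L) / \<delta> + 1"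
      using N \<delta> by (simp add: field_simps)
    finally show "real (card {i \<in> I. R i c}) \<le> (1 + L) / \<delta> + 1" .
  qed
  also have "\<dots> = ((1 + L) / \<delta> + 1) * real (box_count (graph01 F) N)"
    using C(2) by simp
  finally show ?thesis .
qed

section \<open>Arithmetic of the left endpoints\<close>

lemma crt_num_props:
  assumes p: "prime p" and q0: "0 < q0" "q0 < p" and a: "0 < a" "a < p"
  shows "0 < crt_num a0 q0 b p a" "crt_num a0 q0 b p a < int q0 * int p"
    "[crt_num a0 q0 b p a = int a] (mod int p)"
proof -
  have cop: "coprime q0 p"
    using p q0 by (metis coprime_commute nat_dvd_not_less prime_imp_coprime_nat)
  obtain z where z: "[z = a0 * b] (mod q0)" "[z = a] (mod p)" "z < q0 * p"
    using binary_chinese_remainder_unique_nat[OF cop, of "a0 * b" a] q0 by auto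
  define Q where "Q A \<longleftrightarrow> 0 < A \<and> A < int q0 * int p \<and>
    [A = int a0 * int b] (mod int q0) \<and> [A = int a] (mod int p)" for A
  \<comment> \<open>The Chinese remainder theorem only gives a solution in
    \<open>{0..<q0 * p}\<close>; zero is excluded because \<open>p\<close> does not divide
    \<open>a\<close>.\<close>
  have "z \<noteq> 0"
    using z(2) a by (intro notI) (simp add: cong_def)
  then have Qz: "Q (int z)"
    using z by (auto simp: Q_def simp flip: of_nat_mult cong_int_iff)
  have "A = int z" if "Q A" for A
  proof (rule cong_less_imp_eq_int)
    show "[A = int z] (mod int q0 * int p)"
      using that Qz cop unfolding Q_def
      by (intro coprime_cong_mult) (auto intro: cong_trans cong_sym)
  qed (use that Qz in \<open>auto simp: Q_def\<close>)
  then have "Q (THE A. Q A)"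
    using Qz by (rule theI[rotated])
  then show "0 < crt_num a0 q0 b p a" "crt_num a0 q0 b p a < int q0 * int p"
    "[crt_num a0 q0 b p a = int a] (mod int p)"
    by (auto simp: crt_num_def Q_def)
qed

text \<open>Over the common denominator \<open>q * p * p'\<close> the difference has a nonzero
  integer numerator, hence one of absolute value at least 1.\<close>

lemma fraction_separation:
  fixes A A' :: int and p p' q :: nat and M :: real
  assumes "0 < q" "0 < p" "0 < p'" and ne: "A * int p' \<noteq> A' * int p"
    and M: "real p * real p' \<le> M"
  shows "1 / (real q * M) \<le> \<bar>of_int A / (real q * real p) - of_int A' / (real q * real p')\<bar>"
proof -
  have "1 / (real q * M) \<le> 1 / (real q * (real p * real p'))"
    using assms by (intro divide_left_mono mult_left_mono mult_pos_pos) (auto intro: less_le_trans[OF _ M])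
  also have "\<dots> \<le> real_of_int \<bar>A * int p' - A' * int p\<bar> / (real q * (real p * real p'))"
  proof (rule divide_right_mono)
    have "1 \<le> \<bar>A * int p' - A' * int p\<bar>"
      using ne by linarith
    then show "1 \<le> real_of_int \<bar>A * int p' - A' * int p\<bar>"
      by linarith
  qed simp
  also have "\<dots> = \<bar>(real_of_int A * real p' - real_of_int A' * real p) / (real q * (real p * real p'))\<bar>"
    by (simp add: abs_mult)
  also have "(real_of_int A * real p' - real_of_int A' * real p) / (real q * (real p * real p'))
     = of_int A / (real q * real p) - of_int A' / (real q * real p')"
    using assms by (simp add: field_simps)
  finally show ?thesis .
qed

text \<open>For distinct primes, \<open>A p' = A' p\<close> is impossible because \<open>p\<close> does not divide \<open>A\<close>;
  for equal primes it is impossible because \<open>A\<close> determines \<open>a\<close>.\<close>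

lemma crt_num_cross_neq:
  assumes "prime p" "prime p'" "0 < q0" "q0 < p" "q0 < p'" "0 < a" "a < p" "0 < a'" "a' < p'"
    and ne: "(p, a) \<noteq> (p', a')"
  shows "crt_num a0 q0 b p a * int p' \<noteq> crt_num a0 q0 b p' a' * int p"
proof
  let ?A = "crt_num a0 q0 b p a" and ?A' = "crt_num a0 q0 b p' a'"
  assume eq: "?A * int p' = ?A' * int p"
  note A = crt_num_props(3)[OF \<open>prime p\<close> \<open>0 < q0\<close> \<open>q0 < p\<close> \<open>0 < a\<close> \<open>a < p\<close>, of a0 b]
  note A' = crt_num_props(3)[OF \<open>prime p'\<close> \<open>0 < q0\<close> \<open>q0 < p'\<close> \<open>0 < a'\<close> \<open>a' < p'\<close>, of a0 b]
  show False
  proof (cases "p = p'")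
    case True
    then have "?A = ?A'"
      using eq \<open>prime p\<close> prime_gt_0_nat by auto
    then have "[int a = int a'] (mod int p)"
      using A A' True by (metis cong_sym cong_trans)
    then have "a = a'"
      using True assms by (auto simp: cong_int_iff intro: cong_less_modulus_unique_nat)
    then show False
      using True ne by simp
  next
    case False
    have "int p dvd ?A * int p'"
      using eq by simp
    moreover have "\<not> int p dvd int p'"
      using False assms primes_dvd_imp_eq by auto
    ultimately have "int p dvd ?A"
      using \<open>prime p\<close> by (metis prime_dvd_mult_iff prime_nat_int_transfer)
    then have "int p dvd int a"
      using A cong_dvd_iff by metis
    then show False
      using \<open>0 < a\<close> \<open>a < p\<close> by (auto dest: dvd_imp_le)
  qed
qed

section \<open>The sum over the prime window at a fixed scale\<close>

lemma finite_prime_window: "finite (prime_window C1 C2 N)"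
proof (rule finite_subset)
  show "prime_window C1 C2 N \<subseteq> {..nat \<lfloor>C2 * sqrt (real N)\<rfloor>}"
    by (auto simp: prime_window_def le_nat_floor)
qed simp

text \<open>The double counting bound with \<open>L = 1 / C1\<^sup>2\<close> and
  \<open>\<delta> = 1 / (real q0 * C2\<^sup>2)\<close>. The condition on \<open>N\<close> forces
  \<open>q0 < p\<close> throughout the window, so \<open>crt_num\<close> is well defined
  there.\<close>

lemma window_sum_le_box_count:
  fixes F :: "real \<Rightarrow> real"
  assumes cont: "continuous_on {0..1} F" and q0: "0 < q0" and C: "0 < C1"
    and N: "real q0 < C1 * sqrt (real N)"
  shows "real N * (\<Sum>p\<in>prime_window C1 C2 N. \<Sum>a\<in>quad_residues p. osc F (D_interval a0 q0 b p a))
    \<le> ((1 + 1 / C1\<^sup>2) * (real q0 * C2\<^sup>2) + 1) * real (box_count (graph01 F) N)"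
proof -
  let ?P = "prime_window C1 C2 N"
  define I where "I = Sigma ?P quad_residues"
  define x where "x = (\<lambda>(p, a). real_of_int (crt_num a0 q0 b p a) / (real q0 * real p))"
  define l where "l = (\<lambda>(p :: nat, a :: nat). 1 / (real p)\<^sup>2)"
  have "N \<noteq> 0"
    using N by (intro notI) simp
  then have Npos: "N > 0" by simp
  have fin: "finite (quad_residues p)" for p
    by (rule finite_subset[of _ "{..<p}"]) (auto simp: quad_residues_def)
  have P: "prime p" "q0 < p" "C1\<^sup>2 * real N \<le> (real p)\<^sup>2" "real p \<le> C2 * sqrt (real N)"
    if "p \<in> ?P" for p
  proof -
    from that show "prime p" "real p \<le> C2 * sqrt (real N)"
      by (auto simp: prime_window_def)
    have le: "C1 * sqrt (real N) \<le> real p"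
      using that by (auto simp: prime_window_def)
    then show "q0 < p"
      using N by linarith
    have "(C1 * sqrt (real N))\<^sup>2 \<le> (real p)\<^sup>2"
      using le C by (intro power_mono) auto
    then show "C1\<^sup>2 * real N \<le> (real p)\<^sup>2"
      by (simp add: power_mult_distrib)
  qed
  have C2: "C2 > 0" if "p \<in> ?P" for p
  proof -
    have "0 < C2 * sqrt (real N)"
      using P(2,4)[OF that] by linarith
    then show ?thesis
      using Npos by (simp add: zero_less_mult_iff)
  qed
  \<comment> \<open>Any prime in the window forces \<open>C2 > 0\<close>, which makes
    \<open>\<delta>\<close> positive; for an empty window the sum is 0.\<close>
  have "real N * (\<Sum>i\<in>I. osc F {x i .. x i + l i})
    \<le> ((1 + 1 / C1\<^sup>2) / (1 / (real q0 * C2\<^sup>2)) + 1) * real (box_count (graph01 F) N)"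
    if "?P \<noteq> {}"
  proof (rule sum_osc_le_box_count[OF cont Npos])
    show "finite I"
      unfolding I_def by (intro finite_SigmaI finite_prime_window fin)
    show "0 \<le> 1 / C1\<^sup>2" by simp
    show "0 < 1 / (real q0 * C2\<^sup>2)"
      using q0 C2 that by fastforce
    fix i assume "i \<in> I"
    then obtain p a where i: "i = (p, a)" "p \<in> ?P" and a: "0 < a" "a < p"
      by (auto simp: I_def quad_residues_def)
    note A = crt_num_props[OF P(1)[OF i(2)] q0 P(2)[OF i(2)] a, of a0 b]
    have "l i \<le> 1 / (C1\<^sup>2 * real N)"
      unfolding l_def i(1) using P(2,3)[OF i(2)] C Npos by (auto intro!: divide_left_mono)
    then show "l i \<le> 1 / C1\<^sup>2 / real N" by simp
    \<comment> \<open>Integrality leaves a gap of at least \<open>1 / (q0 * p)\<close> between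
      \<open>x i\<close> and 1, and \<open>q0 < p\<close> makes the length
      \<open>1 / p\<^sup>2\<close> fit into it.\<close>
    have "real_of_int (crt_num a0 q0 b p a) \<le> real q0 * real p - 1"
      using A(2) by (simp flip: of_nat_mult)
    then have "x i \<le> (real q0 * real p - 1) / (real q0 * real p)"
      unfolding x_def i(1) by (auto intro: divide_right_mono)
    also have "\<dots> = 1 - 1 / (real q0 * real p)"
      using q0 a by (simp add: field_simps)
    also have "\<dots> \<le> 1 - l i"
      unfolding l_def i(1) power2_eq_square using P(2)[OF i(2)] q0
      by (auto intro!: divide_left_mono mult_right_mono)
    finally show "0 \<le> x i \<and> 0 \<le> l i \<and> x i + l i \<le> 1"
      using A(1) by (auto simp: x_def l_def i(1))
    fix j assume "j \<in> I" "i \<noteq> j"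
    then obtain p' a' where j: "j = (p', a')" "p' \<in> ?P" and a': "0 < a'" "a' < p'"
      by (auto simp: I_def quad_residues_def)
    have "real p * real p' \<le> (C2 * sqrt (real N)) * (C2 * sqrt (real N))"
      using P(4)[OF i(2)] P(4)[OF j(2)] C2[OF i(2)] by (intro mult_mono) auto
    also have "\<dots> = C2\<^sup>2 * real N"
      by (simp add: power2_eq_square)
    finally have "1 / (real q0 * (C2\<^sup>2 * real N)) \<le> \<bar>x i - x j\<bar>"
      unfolding x_def i(1) j(1) prod.case
      using a a' q0 \<open>i \<noteq> j\<close> i j P
      by (intro fraction_separation crt_num_cross_neq) auto
    then show "1 / (real q0 * C2\<^sup>2) / real N \<le> \<bar>x i - x j\<bar>"
      by (simp add: mult.assoc)
  qed
  moreover have "(\<Sum>p\<in>?P. \<Sum>a\<in>quad_residues p. osc F (D_interval a0 q0 b p a))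
    = (\<Sum>i\<in>I. osc F {x i .. x i + l i})"
    unfolding I_def using fin finite_prime_window
    by (subst sum.Sigma) (auto simp: x_def l_def D_interval_def Let_def intro!: sum.cong)
  ultimately show ?thesis
    by (cases "?P = {}") auto
qed

section \<open>Passage to logarithms and the lower limit\<close>

lemma elog_div_ln_le:
  assumes "s \<le> K * t" "K > 0" "t \<ge> 0" "N \<ge> 2"
  shows "elog s / ereal (ln (real N)) \<le> ereal (ln K / ln (real N)) + elog t / ereal (ln (real N))"
proof (cases "s > 0")
  case True
  then have t: "t > 0"
    using assms by (metis less_le_trans mult_zero_right order_le_less)
  have "ln s \<le> ln (K * t)"
    using True assms(1) by simp
  also have "\<dots> = ln K + ln t"
    using assms(2) t by (simp add: ln_mult)
  finally have "ln s / ln (real N) \<le> (ln K + ln t) / ln (real N)"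
    using assms(4) by (intro divide_right_mono) auto
  then show ?thesis
    using True t assms(4) by (simp add: elog_def add_divide_distrib)
\<comment> \<open>Here \<open>elog s\<close> is minus infinity, and dividing by the positive
  \<open>ln (real N)\<close> keeps it so.\<close>
next
  case False
  then show ?thesis
    using assms(4) by (simp add: elog_def)
qed

theorem lemma3p4:
  fixes lam :: "int \<Rightarrow> complex"
    and a0 q0 b B :: nat
    and \<eta> C1 C2 :: real
    and F :: "real \<Rightarrow> real"
  assumes "lam 0 = 0"
    and "\<And>k. lam k = cnj (lam (-k))"
    and "(\<lambda>k. norm (lam k)) summable_on UNIV"
    and "a0 > 0" and "q0 > 0" and "coprime a0 q0"
    and "\<exists>d0::nat. d0 > 0 \<and> squarefree d0 \<and>
           (\<Sum>\<^sub>\<infinity>m\<in>{1::nat..}. lam (int (m\<^sup>2 * d0)) * gauss_mean (int (a0 * m\<^sup>2 * d0)) q0) \<noteq> 0"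
    and "b > 0" and "B > 0" and "8 * q0 dvd B" and "coprime b B"
    and "\<eta> > 0"
    and "\<And>p::nat. prime p \<Longrightarrow> odd p \<Longrightarrow> [p = b] (mod B) \<Longrightarrow>
           norm (\<Sum>\<^sub>\<infinity>k::int. lam k * gauss_mean (k * int a0) q0 * of_int (Legendre k (int p))) \<ge> \<eta>"
    and "0 < C1" and "C1 < C2"
    and "continuous_on {0..1} F"
  shows "lower_box_dim (graph01 F) \<ge>
    liminf (\<lambda>N. elog (real N *
        (\<Sum>p\<in>prime_window C1 C2 N. \<Sum>a\<in>quad_residues p. osc F (D_interval a0 q0 b p a)))
      / ereal (ln (real N)))"
proof -
  define S where "S N = real N *
    (\<Sum>p\<in>prime_window C1 C2 N. \<Sum>a\<in>quad_residues p. osc F (D_interval a0 q0 b p a))" for N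
  define t where "t N = real (box_count (graph01 F) N)" for N
  define K where "K = (1 + 1 / C1\<^sup>2) * (real q0 * C2\<^sup>2) + 1"
  have K: "K > 0"
    unfolding K_def by (intro add_nonneg_pos mult_nonneg_nonneg) auto
  have "filterlim (\<lambda>N. C1 * sqrt (real N)) at_top sequentially"
    using \<open>0 < C1\<close> by real_asymp
  then have "\<forall>\<^sub>F N in sequentially. real q0 < C1 * sqrt (real N)"
    by (simp add: filterlim_at_top_dense)
  then have "\<forall>\<^sub>F N in sequentially. elog (S N) / ereal (ln (real N))
    \<le> ereal (ln K / ln (real N)) + elog (t N) / ereal (ln (real N))"
    using eventually_ge_at_top[of 2]
  proof eventually_elim
    case (elim N)
    show ?case
    proof (rule elog_div_ln_le[OF _ K _ elim(2)])
      show "S N \<le> K * t N"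
        unfolding S_def t_def K_def
        by (rule window_sum_le_box_count[OF assms(16,5,14) elim(1)])
    qed (simp add: t_def)
  qed
  then have "liminf (\<lambda>N. elog (S N) / ereal (ln (real N)))
    \<le> liminf (\<lambda>N. ereal (ln K / ln (real N)) + elog (t N) / ereal (ln (real N)))"
    by (rule Liminf_mono)
  \<comment> \<open>A summand with a finite limit may be taken out of the lower limit; this one
    tends to 0 since \<open>K\<close> is independent of \<open>N\<close>.\<close>
  also have "\<dots> = 0 + liminf (\<lambda>N. elog (t N) / ereal (ln (real N)))"
  proof (rule ereal_liminf_lim_add)
    have "(\<lambda>N. ln K / ln (real N)) \<longlonglongrightarrow> 0"
      by real_asymp
    then show "(\<lambda>N. ereal (ln K / ln (real N))) \<longlonglongrightarrow> 0"
      by (simp add: zero_ereal_def)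
  qed simp
  finally show ?thesis
    by (simp add: S_def t_def lower_box_dim_def)
qed

end
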